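(* Let $\mathcal R=\langle R\mid\nu,\mu\rangle$ be an $(m_r,n_r)$-ring, with totally associative multiplication $\mu$, and let $\mathsf G=\langle G\mid\mu_{\mathsf G}\rangle$ be an $n_g$-ary group. Let $\ell_n,\ell_g\ge1$ with $\ell_n>1$ or $\ell_g>1$ (or both), let $N=\ell_n(n_r-1)+1=\ell_g(n_g-1)+1$, and suppose that $N>n_r$ or $N>n_g$. Let $S$ be the set of formal sums with coefficients in $R$ and basis $G$, and let $\boldsymbol\mu:S^N\to S$ be the multiplication of the higher power polyadic group ring, $$\boldsymbol\mu\Big[\sum_{g} r_g(1)\bullet g,\ldots,\sum_g r_g(N)\bullet g\Big]=\sum_{g_1\in G}\cdots\sum_{g_N\in G}\mu^{\circ\ell_n}\big[r_{g_1}(1),\ldots,r_{g_N}(N)\big]\bullet\mu_{\mathsf G}^{\circ\ell_g}\big[g_1,\ldots,g_N\big].$$ Then $\boldsymbol\mu$ is totally associative.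
   Context: All arities are integers $\ge 2$. An $n$-ary operation $\mu:X^n\to X$ is totally associative if, for all $x_1,\dots,x_{2n-1}\in X$, the value $\mu[x_1,\dots,x_{i-1},\mu[x_i,\dots,x_{i+n-1}],x_{i+n},\dots,x_{2n-1}]$ does not depend on $i\in\{1,\dots,n\}$; then $\langle X\mid\mu\rangle$ is an $n$-ary semigroup. For $\ell\ge1$, $\mu^{\circ\ell}$ denotes the $\ell$-fold composition of $\mu$ with itself (it contains $\ell$ copies of $\mu$; by associativity the bracketing is irrelevant); it takes exactly $\ell(n-1)+1$ arguments. An $n$-ary group is an $n$-ary semigroup in which (for $n\ge3$) every $x$ has a querelement $\bar x$, i.e. $\mu[\bar x,x,\dots,x]=x$ with $\bar x$ in any of the $n$ positions; for $n=2$ it is an ordinary group. An $(m_r,n_r)$-ring $\langle R\mid\nu,\mu\rangle$ is a set with an $m_r$-ary addition $\nu$ making $R$ a commutative $m_r$-ary group, and an $n_r$-ary multiplication $\mu$ making $R$ an $n_r$-ary semigroup, such that $\mu$ distributes over $\nu$ in each of its $n_r$ arguments. A polyadic zero of $\mathcal R$, if it exists, is an element $z_R\in R$ with $\nu[r,z_R,\dots,z_R]=r$ for all $r$ and with $\mu[r_1,\dots,r_{n_r}]=z_R$ whenever some $r_i=z_R$. Formal sums: an element of $S$ is a formal sum $\sum_{g\in G}r_g\bullet g$, i.e. a family $(r_g)_{g\in G}$ of elements of $R$. If $\mathcal R$ has a polyadic zero $z_R$, all but finitely many $r_g$ are required to equal $z_R$ (and such terms may be omitted); if $\mathcal R$ has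 no polyadic zero, $G$ is finite and all families are allowed. In a product of formal sums, the coefficients of terms with the same group element $u$ are gathered into one coefficient by an iterate of $\nu$ (when $z_R$ exists, terms with coefficient $z_R$ may be added or dropped so that the number of summands becomes of the form $\ell(m_r-1)+1$; when there is no polyadic zero it is assumed, so that the product is defined, that for every $u\in G$ the number of $N$-tuples with product $u$ has the form $\ell(m_r-1)+1$ with $\ell\ge0$). *)

theory Defs
  imports "HOL-Algebra.Group" "HOL-Library.Multiset" "HOL-Library.FuncSet"
begin

text \<open>
  An \<open>n\<close>-ary operation on a carrier set \<open>X\<close> is a function \<open>f\<close> on lists; only its values on
  lists of length \<open>n\<close> with entries in \<open>X\<close> are meaningful.
\<close>

definition nary_op :: "nat \<Rightarrow> 'a set \<Rightarrow> ('a list \<Rightarrow> 'a) \<Rightarrow> bool" where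
  "nary_op n X f \<longleftrightarrow> (\<forall>xs. length xs = n \<and> set xs \<subseteq> X \<longrightarrow> f xs \<in> X)"

text \<open>Being totally associative includes being an operation \<open>X\<^sup>n \<rightarrow> X\<close>, i.e. closure.
  Positions \<open>i\<close> are counted from 0.\<close>

definition totally_associative :: "nat \<Rightarrow> 'a set \<Rightarrow> ('a list \<Rightarrow> 'a) \<Rightarrow> bool" where
  "totally_associative n X f \<longleftrightarrow>
     nary_op n X f \<and>
     (\<forall>xs. length xs = 2 * n - 1 \<and> set xs \<subseteq> X \<longrightarrow>
       (\<forall>i<n. \<forall>j<n.
          f (take i xs @ [f (take n (drop i xs))] @ drop (i + n) xs) =
          f (take j xs @ [f (take n (drop j xs))] @ drop (j + n) xs)))"

definition nary_semigroup :: "nat \<Rightarrow> 'a set \<Rightarrow> ('a list \<Rightarrow> 'a) \<Rightarrow> bool" where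
  "nary_semigroup n X f \<longleftrightarrow> n \<ge> 2 \<and> totally_associative n X f"

text \<open>\<open>iter n f l\<close> is the \<open>l\<close>-fold composition of the \<open>n\<close>-ary operation \<open>f\<close> with itself, bracketed
  to the left; it is meant for lists of length \<open>l * (n - 1) + 1\<close>. For \<open>l = 0\<close> it is the
  identity on one argument.\<close>

primrec iter :: "nat \<Rightarrow> ('a list \<Rightarrow> 'a) \<Rightarrow> nat \<Rightarrow> 'a list \<Rightarrow> 'a" where
  "iter n f 0 xs = hd xs"
| "iter n f (Suc l) xs = iter n f l (f (take n xs) # drop n xs)"

definition querelement :: "nat \<Rightarrow> ('a list \<Rightarrow> 'a) \<Rightarrow> 'a \<Rightarrow> 'a \<Rightarrow> bool" where
  "querelement n f x q \<longleftrightarrow> (\<forall>i<n. f ((replicate n x)[i := q]) = x)"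

definition nary_group :: "nat \<Rightarrow> 'a set \<Rightarrow> ('a list \<Rightarrow> 'a) \<Rightarrow> bool" where
  "nary_group n X f \<longleftrightarrow>
     nary_semigroup n X f \<and>
     (if n = 2
      then \<exists>e. group \<lparr>carrier = X, monoid.mult = (\<lambda>x y. f [x, y]), one = e\<rparr>
      else \<forall>x\<in>X. \<exists>q\<in>X. querelement n f x q)"

definition commutative_nary :: "nat \<Rightarrow> 'a set \<Rightarrow> ('a list \<Rightarrow> 'a) \<Rightarrow> bool" where
  "commutative_nary n X f \<longleftrightarrow>
     (\<forall>xs ys. length xs = n \<and> set xs \<subseteq> X \<and> mset ys = mset xs \<longrightarrow> f ys = f xs)"

definition polyadic_ring ::
  "nat \<Rightarrow> nat \<Rightarrow> 'r set \<Rightarrow> ('r list \<Rightarrow> 'r) \<Rightarrow> ('r list \<Rightarrow> 'r) \<Rightarrow> bool" where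
  "polyadic_ring m n R \<nu> \<mu> \<longleftrightarrow>
     nary_group m R \<nu> \<and> commutative_nary m R \<nu> \<and> nary_semigroup n R \<mu> \<and>
     (\<forall>rs xs i. length rs = n \<and> set rs \<subseteq> R \<and> length xs = m \<and> set xs \<subseteq> R \<and> i < n \<longrightarrow>
        \<mu> (rs[i := \<nu> xs]) = \<nu> (map (\<lambda>x. \<mu> (rs[i := x])) xs))"

text \<open>As the multiplication has at least two arguments, a polyadic zero is unique if it exists.\<close>

definition polyadic_zero ::
  "nat \<Rightarrow> nat \<Rightarrow> 'r set \<Rightarrow> ('r list \<Rightarrow> 'r) \<Rightarrow> ('r list \<Rightarrow> 'r) \<Rightarrow> 'r \<Rightarrow> bool" where
  "polyadic_zero m n R \<nu> \<mu> z \<longleftrightarrow>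
     z \<in> R \<and> (\<forall>r\<in>R. \<nu> (r # replicate (m - 1) z) = r) \<and>
     (\<forall>rs. length rs = n \<and> set rs \<subseteq> R \<and> z \<in> set rs \<longrightarrow> \<mu> rs = z)"

text \<open>A formal sum is the family of its coefficients, an extensional function on \<open>G\<close>.\<close>

definition formal_sums ::
  "nat \<Rightarrow> nat \<Rightarrow> 'r set \<Rightarrow> ('r list \<Rightarrow> 'r) \<Rightarrow> ('r list \<Rightarrow> 'r) \<Rightarrow> 'g set \<Rightarrow> ('g \<Rightarrow> 'r) set" where
  "formal_sums m n R \<nu> \<mu> G =
     {r \<in> G \<rightarrow>\<^sub>E R. \<forall>z. polyadic_zero m n R \<nu> \<mu> z \<longrightarrow> finite {g \<in> G. r g \<noteq> z}}"

text \<open>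
  \<open>gathers m n R \<nu> \<mu> I a s\<close>: the element \<open>s\<close> arises by gathering the coefficients \<open>a i\<close> (\<open>i \<in> I\<close>)
  with an iterate of \<open>\<nu>\<close>: the indices are listed in some order, terms equal to the polyadic zero
  may be omitted, further zero terms \<open>zs\<close> may be added, and the resulting number of summands
  has to be of the form \<open>l * (m - 1) + 1\<close>. If there is no polyadic zero, the conditions force
  \<open>set xs = I\<close> and \<open>zs = []\<close>.
\<close>

definition gathers ::
  "nat \<Rightarrow> nat \<Rightarrow> 'r set \<Rightarrow> ('r list \<Rightarrow> 'r) \<Rightarrow> ('r list \<Rightarrow> 'r) \<Rightarrow> 'i set \<Rightarrow> ('i \<Rightarrow> 'r) \<Rightarrow> 'r \<Rightarrow> bool" where
  "gathers m n R \<nu> \<mu> I a s \<longleftrightarrow>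
     (\<exists>xs zs l. distinct xs \<and> set xs \<subseteq> I \<and>
        (\<forall>i\<in>I - set xs. polyadic_zero m n R \<nu> \<mu> (a i)) \<and>
        (\<forall>z\<in>set zs. polyadic_zero m n R \<nu> \<mu> z) \<and>
        length xs + length zs = l * (m - 1) + 1 \<and>
        s = iter m \<nu> l (map a xs @ zs))"

definition tuples_with_product ::
  "nat \<Rightarrow> 'g set \<Rightarrow> ('g list \<Rightarrow> 'g) \<Rightarrow> nat \<Rightarrow> nat \<Rightarrow> 'g \<Rightarrow> 'g list set" where
  "tuples_with_product ng G \<mu>G lg N u =
     {gs. length gs = N \<and> set gs \<subseteq> G \<and> iter ng \<mu>G lg gs = u}"

text \<open>The argument \<open>rs\<close> is the list of the \<open>N\<close> factors; the product is given by its coefficient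
  at each \<open>u \<in> G\<close>. The gathered value is independent of the choices made in gathering.\<close>

definition group_ring_mult ::
  "nat \<Rightarrow> nat \<Rightarrow> 'r set \<Rightarrow> ('r list \<Rightarrow> 'r) \<Rightarrow> ('r list \<Rightarrow> 'r) \<Rightarrow>
   nat \<Rightarrow> 'g set \<Rightarrow> ('g list \<Rightarrow> 'g) \<Rightarrow> nat \<Rightarrow> nat \<Rightarrow> nat \<Rightarrow> ('g \<Rightarrow> 'r) list \<Rightarrow> ('g \<Rightarrow> 'r)" where
  "group_ring_mult m n R \<nu> \<mu> ng G \<mu>G ln lg N rs =
     (\<lambda>u\<in>G. THE s. gathers m n R \<nu> \<mu> (tuples_with_product ng G \<mu>G lg N u)
        (\<lambda>gs. iter n \<mu> ln (map2 (\<lambda>r g. r g) rs gs)) s)"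

end

theory Submission
  imports Defs
begin

text \<open>
  However the product of \<open>2 * N - 1\<close> formal sums \<open>x\<^sub>1, x\<^sub>2, \<dots>\<close> is nested, its coefficient at
  \<open>u \<in> G\<close> is the sum, over all tuples \<open>k\<close> of \<open>2 * N - 1\<close> basis elements with iterated product \<open>u\<close>,
  of the iterated products of the coefficients \<open>x\<^sub>1 k\<^sub>1, x\<^sub>2 k\<^sub>2, \<dots>\<close>. This description does
  not mention the position of the inner product, so total associativity follows
  (\<open>nested_product_gathers\<close>).

  The computation is the one for ordinary group rings. The outer coefficient is a sum over
  \<open>N\<close>-tuples, one factor of each term being the inner coefficient, itself a sum over \<open>N\<close>-tuples.
  Distributivity moves the inner sum out of the product (\<open>iter_mult_additive\<close>), a nested sum is
  a sum over pairs (\<open>gathers_Sigma\<close>), general associativity of the two multiplications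
  (\<open>iter_absorb\<close>) merges each pair into one long product of coefficients and of basis elements,
  and substituting the inner tuple for its product in the outer tuple is a bijection from
  these pairs to the long tuples with product \<open>u\<close> (\<open>substitute_tuple_bij\<close>).

  What differs from the binary case is the meaning of a sum. Only \<open>l * (m - 1) + 1\<close> elements can
  be added at once, and a neutral element for padding may not exist. Hence a sum is treated as
  a relation \<open>sums_to\<close> between a multiset of coefficients and its value. It ignores zeros, which
  covers in the same way a ring with a polyadic zero, where \<open>G\<close> may be infinite, and one without,
  where there is nothing to ignore and the number of summands has to be right. General
  associativity and commutativity of the addition make the value unique
  (\<open>iter_add_cong_nonzeros\<close>) and allow replacing a summand by any multiset with that sum
  (\<open>sums_to_subst\<close>), which is all that the interchange of sums needs.
\<close>

section \<open>Iterates of a totally associative operation\<close>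

lemma iter_closed:
  assumes "nary_op n X f" "n \<ge> 2" "length xs = l * (n - 1) + 1" "set xs \<subseteq> X"
  shows "iter n f l xs \<in> X"
  using assms(3,4)
proof (induction l arbitrary: xs)
  case 0
  then show ?case by (cases xs) auto
next
  case (Suc l)
  have "f (take n xs) \<in> X"
    using assms(1,2) Suc.prems set_take_subset[of n xs] by (auto simp: nary_op_def)
  moreover have "length (f (take n xs) # drop n xs) = l * (n - 1) + 1"
    using assms(2) Suc.prems by auto
  ultimately show ?case
    using Suc.IH[of "f (take n xs) # drop n xs"] Suc.prems(2) set_drop_subset[of n xs] by auto
qed

text \<open>
  General associativity for a single inner application. As \<open>iter\<close> brackets to the left,
  the first application of \<open>f\<close> either lies to the left of the inner product, and the rest is
  shorter, or it overlaps the inner product; then total associativity moves the inner product to the front.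
\<close>

lemma iter_absorb_single:
  assumes "totally_associative n X f" "n \<ge> 2" "length xs + length zs = k * (n - 1)"
    "length ys = n" "set xs \<subseteq> X" "set ys \<subseteq> X" "set zs \<subseteq> X"
  shows "iter n f (Suc k) (xs @ ys @ zs) = iter n f k (xs @ f ys # zs)"
  using assms(3-)
proof (induction k arbitrary: xs zs)
  case 0
  then show ?case by auto
next
  case (Suc k)
  have op: "f ws \<in> X" if "length ws = n" "set ws \<subseteq> X" for ws
    using that assms(1) by (auto simp: totally_associative_def nary_op_def)
  show ?case
  proof (cases "length xs \<ge> n")
    case True
    have "set (take n xs) \<subseteq> X" "set (drop n xs) \<subseteq> X"
      using Suc.prems(3) set_take_subset set_drop_subset by fastforce+
    moreover from this have "f (take n xs) \<in> X"
      using True by (intro op) auto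
    ultimately have "iter n f (Suc k) ((f (take n xs) # drop n xs) @ ys @ zs) =
        iter n f k ((f (take n xs) # drop n xs) @ f ys # zs)"
      using Suc.prems True assms(2) by (intro Suc.IH) auto
    then show ?thesis using True by simp
  next
    case False
    \<comment> \<open>The first application of \<open>f\<close> meets the block \<open>ys\<close>: the two share a window of
       \<open>2 * n - 1\<close> entries, to which total associativity applies.\<close>
    define p where "p = n - 1 - length xs"
    define us where "us = take p zs"
    define vs where "vs = drop p zs"
    have zs: "zs = us @ vs" by (simp add: us_def vs_def)
    have len: "length us = p"
      using Suc.prems(1) False assms(2) by (auto simp: us_def p_def)
    define W where "W = xs @ ys @ us"
    have W: "length W = 2 * n - 1" "set W \<subseteq> X"
      using len Suc.prems False assms(2) zs by (auto simp: W_def p_def)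
    have "f (take 0 W @ [f (take n (drop 0 W))] @ drop (0 + n) W) =
        f (take (length xs) W @ [f (take n (drop (length xs) W))] @ drop (length xs + n) W)"
      using assms(1,2) W False unfolding totally_associative_def by (metis not_le gr0I le_zero_eq zero_neq_numeral)
    then have eq: "f (f (take n W) # drop n W) = f (xs @ f ys # us)"
      using Suc.prems by (simp add: W_def)
    have "iter n f (Suc (Suc k)) (W @ vs) = iter n f k (f (f (take n W) # drop n W) # vs)"
      using W(1) assms(2) by (cases n) auto
    also have "\<dots> = iter n f (Suc k) ((xs @ f ys # us) @ vs)"
    proof -
      have "length (xs @ f ys # us) = n"
        using len False by (simp add: p_def)
      then have "take n ((xs @ f ys # us) @ vs) = xs @ f ys # us"
        and "drop n ((xs @ f ys # us) @ vs) = vs"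
        by (simp_all only: append_eq_conv_conj[symmetric] take_append drop_append) auto
      then show ?thesis
        by (simp only: iter.simps eq)
    qed
    finally show ?thesis by (simp add: W_def zs)
  qed
qed

text \<open>General associativity; every bracketing that occurs below is an instance.\<close>

lemma iter_absorb:
  assumes "totally_associative n X f" "n \<ge> 2" "length xs + length zs = k * (n - 1)"
    "length ys = l * (n - 1) + 1" "set xs \<subseteq> X" "set ys \<subseteq> X" "set zs \<subseteq> X"
  shows "iter n f (k + l) (xs @ ys @ zs) = iter n f k (xs @ iter n f l ys # zs)"
  using assms(4,6)
proof (induction l arbitrary: ys)
  case 0
  then show ?case by (cases ys) auto
next
  case (Suc l)
  define us where "us = take n ys"
  define vs where "vs = drop n ys"
  have ys: "ys = us @ vs" by (simp add: us_def vs_def)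
  have len: "length us = n" "length vs = l * (n - 1)"
    using Suc.prems(1) assms(2) by (auto simp: us_def vs_def)
  have "f us \<in> X"
    using assms(1) len ys Suc.prems by (auto simp: totally_associative_def nary_op_def)
  then have "iter n f k (xs @ iter n f l (f us # vs) # zs) = iter n f (k + l) (xs @ (f us # vs) @ zs)"
    using len ys Suc.prems by (intro Suc.IH[symmetric]) auto
  also have "\<dots> = iter n f (Suc (k + l)) (xs @ us @ (vs @ zs))"
    using assms(1,2,3,5-7) len ys Suc.prems(2)
    by (subst iter_absorb_single[where X = X]) (auto simp: add_mult_distrib simp del: One_nat_def)
  finally show ?case by (simp add: ys len)
qed

text \<open>
  Selection sort: the head of \<open>ys\<close> is found by moving the required entry to the front through
  adjacent swaps. The prefix \<open>us\<close> of the inductive statement is the part on which the two lists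
  already agree.
\<close>

lemma perm_invariant_if_swap_invariant:
  assumes swap: "\<And>us x y vs. length (us @ x # y # vs) = k \<Longrightarrow> set (us @ x # y # vs) \<subseteq> X \<Longrightarrow>
      f (us @ x # y # vs) = f (us @ y # x # vs)"
    and "length xs = k" "set xs \<subseteq> X" "mset xs = mset ys"
  shows "f xs = f ys"
proof -
  have front: "f (us @ x # ws @ vs) = f (us @ ws @ x # vs)"
    if "length (us @ x # ws @ vs) = k" "set (us @ x # ws @ vs) \<subseteq> X" for us x ws vs
    using that
  proof (induction ws arbitrary: us)
    case Nil
    then show ?case by simp
  next
    case (Cons w ws)
    have "f (us @ x # w # ws @ vs) = f (us @ w # x # ws @ vs)"
      using Cons.prems by (intro swap) auto
    also have "\<dots> = f ((us @ [w]) @ ws @ x # vs)"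
      using Cons.prems Cons.IH[of "us @ [w]"] by simp
    finally show ?case by simp
  qed
  have "f (us @ xs) = f (us @ ys)"
    if "length (us @ xs) = k" "set (us @ xs) \<subseteq> X" "mset xs = mset ys" for us
    using that
  proof (induction xs arbitrary: us ys)
    case Nil
    then show ?case by simp
  next
    case (Cons x xs)
    have "x \<in> set ys"
      using Cons.prems(3) by (metis list.set_intros(1) set_mset_mset)
    then obtain as bs where ys: "ys = as @ x # bs"
      by (meson split_list)
    have "mset xs = mset (as @ bs)"
      using Cons.prems(3) by (simp add: ys)
    then have "f ((us @ [x]) @ xs) = f ((us @ [x]) @ as @ bs)"
      using Cons.prems(1,2) by (intro Cons.IH) auto
    also have "\<dots> = f (us @ as @ x # bs)"
    proof -
      have "length (as @ bs) = length xs" "set (as @ bs) = set xs"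
        using \<open>mset xs = mset (as @ bs)\<close> by (metis size_mset, metis set_mset_mset)
      then show ?thesis
        using Cons.prems(1,2) front[of us x as bs] by simp
    qed
    finally show ?case by (simp add: ys)
  qed
  from this[of "[]"] assms(2-) show ?thesis by simp
qed

text \<open>
  Two neighbours always fit into a common window of length \<open>n \<ge> 2\<close>, and by general associativity
  the operation can be taken to be applied to that window first.
\<close>

lemma iter_permute:
  assumes "totally_associative n X f" "commutative_nary n X f" "n \<ge> 2"
    "length xs = l * (n - 1) + 1" "set xs \<subseteq> X" "mset xs = mset ys"
  shows "iter n f l xs = iter n f l ys"
proof (rule perm_invariant_if_swap_invariant[OF _ assms(4-6)])
  fix us x y vs
  assume len: "length (us @ x # y # vs) = l * (n - 1) + 1" and X: "set (us @ x # y # vs) \<subseteq> X"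
  obtain k where l: "l = Suc k"
    using len by (cases l) auto
  \<comment> \<open>A window of \<open>n\<close> entries around the two neighbours, as far to the left as possible
     without crossing the left end.\<close>
  define p where "p = length us - (n - 2)"
  define q where "q = n - 2 - (length us - p)"
  define as where "as = take p us"
  define bs where "bs = drop p us"
  define cs where "cs = take q vs"
  define ds where "ds = drop q vs"
  have us: "us = as @ bs" and vs: "vs = cs @ ds"
    by (simp_all add: as_def bs_def cs_def ds_def)
  have "n - 1 \<le> length us + length vs + 1"
    using len by (simp add: l)
  then have lens: "length (bs @ x # y # cs) = n"
    using assms(3) by (auto simp: bs_def cs_def p_def q_def)
  then have sum: "length as + length ds = k * (n - 1)"
    using len assms(3) by (auto simp: us vs l)
  have absorb: "iter n f (Suc k) (as @ ws @ ds) = iter n f k (as @ f ws # ds)"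
    if "length ws = n" "set ws \<subseteq> X" for ws
    using that X sum assms(1,3) by (intro iter_absorb_single[where X = X]) (auto simp: us vs)
  have "f (bs @ y # x # cs) = f (bs @ x # y # cs)"
    using assms(2) lens X unfolding commutative_nary_def
    by (intro assms(2)[unfolded commutative_nary_def, rule_format]) (auto simp: us vs)
  then show "iter n f l (us @ x # y # vs) = iter n f l (us @ y # x # vs)"
    using absorb[of "bs @ x # y # cs"] absorb[of "bs @ y # x # cs"] lens X
    by (simp add: us vs l del: iter.simps)
qed

section \<open>Sums of multisets in a polyadic ring\<close>

locale polyadic_coefficient_ring =
  fixes m n :: nat and R :: "'r set" and \<nu> \<mu> :: "'r list \<Rightarrow> 'r"
  assumes ring: "polyadic_ring m n R \<nu> \<mu>"
begin

abbreviation is_zero :: "'r \<Rightarrow> bool" where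
  "is_zero \<equiv> polyadic_zero m n R \<nu> \<mu>"

abbreviation nonzeros :: "'r multiset \<Rightarrow> 'r multiset" where
  "nonzeros M \<equiv> {#x \<in># M. \<not> is_zero x#}"

lemma
  shows add_assoc: "totally_associative m R \<nu>"
    and add_comm: "commutative_nary m R \<nu>"
    and m_ge_2: "m \<ge> 2"
    and mult_assoc: "totally_associative n R \<mu>"
    and n_ge_2: "n \<ge> 2"
  using ring by (auto simp: polyadic_ring_def nary_group_def nary_semigroup_def)

lemma distrib:
  assumes "length rs = n" "set rs \<subseteq> R" "length xs = m" "set xs \<subseteq> R" "i < n"
  shows "\<mu> (rs[i := \<nu> xs]) = \<nu> (map (\<lambda>x. \<mu> (rs[i := x])) xs)"
  using ring assms unfolding polyadic_ring_def by blast

lemma add_closed: "length xs = m \<Longrightarrow> set xs \<subseteq> R \<Longrightarrow> \<nu> xs \<in> R"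
  using add_assoc by (auto simp: totally_associative_def nary_op_def)

lemma mult_closed: "length xs = n \<Longrightarrow> set xs \<subseteq> R \<Longrightarrow> \<mu> xs \<in> R"
  using mult_assoc by (auto simp: totally_associative_def nary_op_def)

lemma iter_add_closed: "length xs = l * (m - 1) + 1 \<Longrightarrow> set xs \<subseteq> R \<Longrightarrow> iter m \<nu> l xs \<in> R"
  using add_assoc m_ge_2 by (intro iter_closed) (auto simp: totally_associative_def)

lemma iter_mult_closed: "length xs = l * (n - 1) + 1 \<Longrightarrow> set xs \<subseteq> R \<Longrightarrow> iter n \<mu> l xs \<in> R"
  using mult_assoc n_ge_2 by (intro iter_closed) (auto simp: totally_associative_def)

lemma zero_in: "is_zero z \<Longrightarrow> z \<in> R"
  by (simp add: polyadic_zero_def)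

lemma zero_unique:
  assumes "is_zero z" "is_zero z'"
  shows "z = z'"
proof -
  define rs where "rs = z # z' # replicate (n - 2) z"
  have "length rs = n" "set rs \<subseteq> R" "z \<in> set rs" "z' \<in> set rs"
    using n_ge_2 assms by (auto simp: rs_def zero_in)
  then show ?thesis using assms unfolding polyadic_zero_def by metis
qed

lemma zero_iff: "is_zero z \<Longrightarrow> is_zero x \<longleftrightarrow> x = z"
  using zero_unique by blast

text \<open>By commutativity each block of \<open>m - 1\<close> zeros can be moved next to the first summand,
  which absorbs it.\<close>

lemma iter_add_padding:
  assumes "is_zero z" "length ws = l * (m - 1) + 1" "set ws \<subseteq> R"
  shows "iter m \<nu> (q + l) (ws @ replicate (q * (m - 1)) z) = iter m \<nu> l ws"
proof (induction q)
  case 0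
  then show ?case by simp
next
  case (Suc q)
  obtain w us where ws: "ws = w # us"
    using assms(2) by (cases ws) auto
  define vs where "vs = us @ replicate (q * (m - 1)) z"
  have "iter m \<nu> (Suc q + l) (ws @ replicate (Suc q * (m - 1)) z) =
      iter m \<nu> (Suc q + l) ((w # replicate (m - 1) z) @ vs)"
  proof (rule iter_permute[OF add_assoc add_comm m_ge_2])
    show "length (ws @ replicate (Suc q * (m - 1)) z) = (Suc q + l) * (m - 1) + 1"
      using assms(2) by (simp add: add_mult_distrib)
    show "set (ws @ replicate (Suc q * (m - 1)) z) \<subseteq> R"
      using assms(1,3) by (auto simp: zero_in)
  qed (simp add: vs_def ws replicate_add)
  also have "\<dots> = iter m \<nu> (q + l) (\<nu> (w # replicate (m - 1) z) # vs)"
    using m_ge_2 by (cases m) simp_all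
  also have "\<nu> (w # replicate (m - 1) z) = w"
    using assms(1,3) by (simp add: polyadic_zero_def ws)
  finally show ?case using Suc by (simp add: vs_def ws)
qed

lemma mset_split_zero:
  assumes "is_zero z"
  shows "M = nonzeros M + replicate_mset (count M z) z"
  using zero_iff[OF assms] by (intro multiset_eqI) auto

text \<open>
  Two lists with the same nonzero
  summands have lengths that agree modulo \<open>m - 1\<close>, so the shorter becomes a permutation of the
  longer after whole blocks of zeros are appended. Without a zero they are permutations
  of each other from the start.
\<close>

lemma iter_add_cong_nonzeros:
  assumes "set ws \<subseteq> R" "set ws' \<subseteq> R"
    "length ws = l * (m - 1) + 1" "length ws' = l' * (m - 1) + 1"
    "nonzeros (mset ws) = nonzeros (mset ws')"
  shows "iter m \<nu> l ws = iter m \<nu> l' ws'"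
proof -
  have *: "iter m \<nu> l ws = iter m \<nu> l' ws'"
    if le: "l \<le> l'" and prems: "set ws \<subseteq> R" "set ws' \<subseteq> R"
      "length ws = l * (m - 1) + 1" "length ws' = l' * (m - 1) + 1"
      "nonzeros (mset ws) = nonzeros (mset ws')" for l l' ws ws'
  proof -
    obtain d where l': "l' = d + l"
      using le(1) by (metis le_iff_add add.commute)
    show ?thesis
    proof (cases "\<exists>z. is_zero z")
      case True
      then obtain z where z: "is_zero z" ..
      let ?W = "ws @ replicate (d * (m - 1)) z"
      have eq: "mset ws = nonzeros (mset ws) + replicate_mset (count (mset ws) z) z"
        "mset ws' = nonzeros (mset ws) + replicate_mset (count (mset ws') z) z"
        using mset_split_zero[OF z, of "mset ws"] mset_split_zero[OF z, of "mset ws'"] prems(5)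
        by simp_all
      have "length ws = size (nonzeros (mset ws)) + count (mset ws) z"
        "length ws' = size (nonzeros (mset ws)) + count (mset ws') z"
        using arg_cong[OF eq(1), of size] arg_cong[OF eq(2), of size] by simp_all
      then have "count (mset ws') z = count (mset ws) z + d * (m - 1)"
        using prems(3,4) by (simp add: l' add_mult_distrib)
      moreover have "replicate_mset (p + q) z = replicate_mset p z + replicate_mset q z" for p q
        by (rule multiset_eqI) simp
      ultimately have "mset ws' = mset ws + replicate_mset (d * (m - 1)) z"
        using eq by (metis add.assoc)
      then have "mset ws' = mset ?W"
        by simp
      then have "iter m \<nu> l' ws' = iter m \<nu> l' ?W"
        using prems by (intro iter_permute[OF add_assoc add_comm m_ge_2]) auto
      then show ?thesis
        using iter_add_padding[OF z prems(3,1)] by (simp add: l')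
    next
      case False
      then have eq: "mset ws = mset ws'"
        using prems(5) by simp
      then have "l = l'"
        using prems(3,4) m_ge_2 mset_eq_length[OF eq] by simp
      then show ?thesis
        using iter_permute[OF add_assoc add_comm m_ge_2 prems(3,1) eq] by simp
    qed
  qed
  show ?thesis
  proof (cases "l \<le> l'")
    case True
    then show ?thesis using assms by (intro *)
  next
    case False
    then show ?thesis using assms by (intro *[symmetric]) simp_all
  qed
qed

text \<open>
  The sum as a relation, since a multiset of the wrong size has no sum when zeros for padding do
  not exist. Comparing nonzero parts lets the summing list add or omit zeros.
\<close>

definition sums_to :: "'r multiset \<Rightarrow> 'r \<Rightarrow> bool" where
  "sums_to M s \<longleftrightarrow> (\<exists>ws l. set ws \<subseteq> R \<and> length ws = l * (m - 1) + 1 \<and>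
     nonzeros (mset ws) = nonzeros M \<and> s = iter m \<nu> l ws)"

lemma sums_to_unique: "sums_to M s \<Longrightarrow> sums_to M t \<Longrightarrow> s = t"
  unfolding sums_to_def using iter_add_cong_nonzeros by metis

lemma sums_to_closed: "sums_to M s \<Longrightarrow> s \<in> R"
  by (auto simp: sums_to_def intro: iter_add_closed)

lemma sums_to_exists:
  assumes "set_mset M \<subseteq> R" "(\<exists>z. is_zero z) \<or> size M = l * (m - 1) + 1"
  shows "\<exists>s. sums_to M s"
proof -
  obtain xs where xs: "mset xs = M"
    using ex_mset by blast
  show ?thesis
  proof (cases "\<exists>z. is_zero z")
    case True
    then obtain z where z: "is_zero z" ..
    have "length xs \<le> length xs * (m - 1)"
      using m_ge_2 by (cases "m - 1") auto
    then have "length (xs @ replicate (length xs * (m - 1) + 1 - length xs) z) = length xs * (m - 1) + 1"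
      by (simp only: length_append length_replicate)
    moreover have "nonzeros (mset (xs @ replicate k z)) = nonzeros M" for k
      using z xs by simp
    moreover have "set (xs @ replicate k z) \<subseteq> R" for k
      using assms(1) xs zero_in[OF z] by auto
    ultimately show ?thesis unfolding sums_to_def by blast
  next
    case False
    then have "length xs = l * (m - 1) + 1"
      using assms(2) xs by auto
    then show ?thesis
      unfolding sums_to_def using xs assms(1) by (metis set_mset_mset)
  qed
qed

text \<open>An empty sum only exists as a sum of zeros, because at least one summand is required.\<close>

lemma sums_to_empty:
  assumes "sums_to M s" "nonzeros M = {#}"
  shows "is_zero s"
proof -
  obtain ws l where ws: "set ws \<subseteq> R" "length ws = l * (m - 1) + 1"
    "nonzeros (mset ws) = {#}" "s = iter m \<nu> l ws"
    using assms by (auto simp: sums_to_def)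
  then have "hd ws \<in> set ws"
    by (intro hd_in_set) auto
  then have z: "is_zero (hd ws)"
    using ws(3) by (metis (mono_tags, lifting) empty_iff filter_mset_eq_conv set_mset_empty set_mset_filter mem_Collect_eq set_mset_mset)
  have "s = iter m \<nu> 0 [hd ws]"
    unfolding ws(4) using ws z by (intro iter_add_cong_nonzeros) (auto simp: zero_in)
  with z show ?thesis by simp
qed

text \<open>Associativity in terms of multisets: a summand may be replaced by any multiset that
  adds up to it.\<close>

lemma sums_to_subst:
  assumes "sums_to (add_mset b M) s" "sums_to K b"
  shows "sums_to (K + M) s"
proof -
  obtain ws l where ws: "set ws \<subseteq> R" "length ws = l * (m - 1) + 1"
    "nonzeros (mset ws) = nonzeros (add_mset b M)" "s = iter m \<nu> l ws"
    using assms(1) by (auto simp: sums_to_def)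
  \<comment> \<open>If \<open>b\<close> is zero it need not be among the listed summands; padding provides it.\<close>
  have "\<exists>ws l. set ws \<subseteq> R \<and> length ws = l * (m - 1) + 1 \<and>
    nonzeros (mset ws) = nonzeros (add_mset b M) \<and> s = iter m \<nu> l ws \<and> b \<in> set ws"
  proof (cases "is_zero b")
    case True
    show ?thesis
      using ws m_ge_2 True iter_add_padding[OF True ws(2,1), of 1] zero_in[OF True]
      by (intro exI[of _ "ws @ replicate (1 * (m - 1)) b"] exI[of _ "1 + l"]) auto
  next
    case False
    then have "b \<in># nonzeros (mset ws)"
      by (simp add: ws(3))
    then have "b \<in> set ws"
      by simp
    with ws show ?thesis by blast
  qed
  then obtain us vs l where us: "set (us @ b # vs) \<subseteq> R" "length (us @ b # vs) = l * (m - 1) + 1"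
    "nonzeros (mset (us @ b # vs)) = nonzeros (add_mset b M)" "s = iter m \<nu> l (us @ b # vs)"
    by (metis split_list)
  obtain ks k where ks: "set ks \<subseteq> R" "length ks = k * (m - 1) + 1"
    "nonzeros (mset ks) = nonzeros K" "b = iter m \<nu> k ks"
    using assms(2) by (auto simp: sums_to_def)
  have "iter m \<nu> (l + k) (us @ ks @ vs) = s"
    using us ks by (simp add: iter_absorb[OF add_assoc m_ge_2])
  moreover have "length (us @ ks @ vs) = (l + k) * (m - 1) + 1"
    using us(2) ks(2) by (simp add: add_mult_distrib)
  moreover have "nonzeros (mset (us @ ks @ vs)) = nonzeros (K + M)"
    using us(3) ks(3) by (auto split: if_splits)
  ultimately show ?thesis
    unfolding sums_to_def using us(1) ks(1) by (intro exI[of _ "us @ ks @ vs"] exI[of _ "l + k"]) auto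
qed

text \<open>The induction replaces the summands one by one; \<open>M\<close> collects those already replaced.\<close>

lemma sums_to_subst_family:
  assumes "finite I" "sums_to (image_mset b (mset_set I)) s" "\<And>i. i \<in> I \<Longrightarrow> sums_to (K i) (b i)"
  shows "sums_to (\<Sum>i\<in>I. K i) s"
proof -
  have "sums_to ((\<Sum>i\<in>I. K i) + M) s" if "sums_to (image_mset b (mset_set I) + M) s" for M
    using assms(1,3) that
  proof (induction I arbitrary: M)
    case empty
    then show ?case by simp
  next
    case (insert i I)
    have "sums_to (add_mset (b i) (image_mset b (mset_set I) + M)) s"
      using insert.prems(2) insert.hyps by simp
    then have "sums_to (K i + (image_mset b (mset_set I) + M)) s"
      using insert.prems(1) by (intro sums_to_subst) auto
    then have "sums_to (image_mset b (mset_set I) + (K i + M)) s"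
      by (simp add: ac_simps)
    then have "sums_to ((\<Sum>i\<in>I. K i) + (K i + M)) s"
      using insert.prems(1) by (intro insert.IH) auto
    then show ?case
      using insert.hyps by (simp add: ac_simps)
  qed
  from this[of "{#}"] assms(2) show ?thesis by simp
qed

text \<open>
  Endomorphisms of the additive structure. That zeros go to zeros is required separately: it does
  not follow from compatibility with \<open>\<nu>\<close>, as constant maps to an additive idempotent show.
\<close>

definition additive_map :: "('r \<Rightarrow> 'r) \<Rightarrow> bool" where
  "additive_map h \<longleftrightarrow> h ` R \<subseteq> R \<and>
     (\<forall>xs. length xs = m \<and> set xs \<subseteq> R \<longrightarrow> h (\<nu> xs) = \<nu> (map h xs)) \<and>
     (\<forall>z. is_zero z \<longrightarrow> is_zero (h z))"

lemma additive_map_iter: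
  assumes "additive_map h" "length ws = l * (m - 1) + 1" "set ws \<subseteq> R"
  shows "h (iter m \<nu> l ws) = iter m \<nu> l (map h ws)"
  using assms(2,3)
proof (induction l arbitrary: ws)
  case 0
  then show ?case by (cases ws) auto
next
  case (Suc l)
  have sub: "set (take m ws) \<subseteq> R" "set (drop m ws) \<subseteq> R"
    using Suc.prems(2) set_take_subset set_drop_subset by fastforce+
  have len: "length (take m ws) = m"
    using Suc.prems(1) m_ge_2 by simp
  have "h (iter m \<nu> l (\<nu> (take m ws) # drop m ws)) = iter m \<nu> l (map h (\<nu> (take m ws) # drop m ws))"
    using sub len add_closed[OF len sub(1)] Suc.prems(1) m_ge_2 by (intro Suc.IH) auto
  moreover have "h (\<nu> (take m ws)) = \<nu> (map h (take m ws))"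
    using assms(1) len sub by (auto simp: additive_map_def)
  ultimately show ?case
    by (simp add: take_map drop_map)
qed

lemma iter_mult_zero:
  assumes "is_zero z" "z \<in> set xs" "length xs = l * (n - 1) + 1" "set xs \<subseteq> R"
  shows "iter n \<mu> l xs = z"
  using assms(2-)
proof (induction l arbitrary: xs)
  case 0
  then show ?case by (cases xs) auto
next
  case (Suc l)
  have sub: "set (take n xs) \<subseteq> R" "set (drop n xs) \<subseteq> R"
    using Suc.prems(3) set_take_subset set_drop_subset by fastforce+
  have len: "length (take n xs) = n"
    using Suc.prems(2) n_ge_2 by simp
  have "z \<in> set (take n xs) \<or> z \<in> set (drop n xs)"
    using Suc.prems(1) by (metis Un_iff append_take_drop_id set_append)
  moreover have "\<mu> (take n xs) = z" if "z \<in> set (take n xs)"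
    using assms(1) that len sub by (simp add: polyadic_zero_def)
  ultimately have "iter n \<mu> l (\<mu> (take n xs) # drop n xs) = z"
    using sub len mult_closed[OF len sub(1)] Suc.prems(2) n_ge_2 by (intro Suc.IH) auto
  then show ?case by simp
qed

text \<open>
  Distributivity for iterated products. If the variable argument is among the first \<open>n\<close>, it is
  first multiplied by \<open>\<mu>\<close> and the result is argument 0 of the remaining product, so two additive
  maps are composed; otherwise it becomes a later argument of the remaining product.
\<close>

lemma iter_mult_additive:
  assumes "length rs = l * (n - 1) + 1" "set rs \<subseteq> R" "i < length rs"
  shows "additive_map (\<lambda>x. iter n \<mu> l (rs[i := x]))"
proof -
  have upd: "set (rs[i := x]) \<subseteq> R" if "x \<in> R" "set rs \<subseteq> R" for rs :: "'r list" and i x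
    using that set_update_subset_insert[of rs i x] by auto
  have "iter n \<mu> l (rs[i := \<nu> xs]) = \<nu> (map (\<lambda>x. iter n \<mu> l (rs[i := x])) xs)"
    if "length xs = m" "set xs \<subseteq> R" for xs
    using assms that
  proof (induction l arbitrary: rs i xs)
    case 0
    then have "rs[i := x] = [x]" for x
      by (cases rs) auto
    then show ?case by simp
  next
    case (Suc l)
    have sub: "set (take n rs) \<subseteq> R" "set (drop n rs) \<subseteq> R"
      using Suc.prems(2) set_take_subset set_drop_subset by fastforce+
    have len: "length (take n rs) = n" "length (drop n rs) = l * (n - 1)"
      using Suc.prems(1) n_ge_2 by auto
    have prod: "\<mu> (take n rs) \<in> R"
      using len sub by (intro mult_closed) auto
    show ?case
    proof (cases "i < n")
      case True
      let ?g = "\<lambda>x. \<mu> ((take n rs)[i := x])"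
      let ?h = "\<lambda>y. iter n \<mu> l ((\<mu> (take n rs) # drop n rs)[0 := y])"
      have step: "iter n \<mu> (Suc l) (rs[i := x]) = ?h (?g x)" for x
        using True by (simp add: take_update_swap)
      have "?g ` set xs \<subseteq> R"
        using len(1) upd[OF _ sub(1)] Suc.prems(5) by (intro image_subsetI mult_closed) auto
      moreover have "?h (\<nu> ys) = \<nu> (map ?h ys)" if "length ys = m" "set ys \<subseteq> R" for ys
        using Suc.IH[of "\<mu> (take n rs) # drop n rs" 0 ys] len sub prod that by simp
      ultimately have "?h (\<nu> (map ?g xs)) = \<nu> (map ?h (map ?g xs))"
        using Suc.prems(4) by simp
      moreover have "?g (\<nu> xs) = \<nu> (map ?g xs)"
        using distrib[OF len(1) sub(1) Suc.prems(4,5) True] .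
      ultimately show ?thesis
        by (simp only: step map_map comp_def)
    next
      case False
      have "iter n \<mu> (Suc l) (rs[i := x]) = iter n \<mu> l ((\<mu> (take n rs) # drop n rs)[Suc (i - n) := x])" for x
        using False by (simp add: drop_update_swap)
      then show ?thesis
        using Suc.IH[of "\<mu> (take n rs) # drop n rs" "Suc (i - n)" xs] len sub prod Suc.prems(3-5) False
        by simp
    qed
  qed
  moreover have "is_zero (iter n \<mu> l (rs[i := z]))" if "is_zero z" for z
    using iter_mult_zero[OF that, of "rs[i := z]" l] that assms upd[OF zero_in[OF that] assms(2)]
    by (simp add: set_update_memI)
  moreover have "iter n \<mu> l (rs[i := x]) \<in> R" if "x \<in> R" for x
    using assms upd[OF that assms(2)] by (intro iter_mult_closed) auto
  ultimately show ?thesis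
    by (auto simp: additive_map_def)
qed

section \<open>Gathering families of coefficients\<close>

abbreviation gathers_to :: "'i set \<Rightarrow> ('i \<Rightarrow> 'r) \<Rightarrow> 'r \<Rightarrow> bool" where
  "gathers_to \<equiv> gathers m n R \<nu> \<mu>"

abbreviation support :: "'i set \<Rightarrow> ('i \<Rightarrow> 'r) \<Rightarrow> 'i set" where
  "support I a \<equiv> {i \<in> I. \<not> is_zero (a i)}"

lemma nonzeros_image_mset_set:
  assumes "finite J"
  shows "nonzeros (image_mset a (mset_set J)) = image_mset a (mset_set (support J a))"
  using assms by (simp add: filter_mset_image_mset)

text \<open>
  The link between the choices made in \<open>gathers\<close> and multisets. The freedom in \<open>J\<close>, any finite set
  between the support and the whole index set, is essential for nested sums: an inner sum may
  vanish although its terms do not, so its index may not simply be dropped.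
\<close>

lemma gathers_iff_sums_to:
  assumes "finite J" "J \<subseteq> I" "support I a \<subseteq> J" "a ` I \<subseteq> R"
  shows "gathers_to I a s \<longleftrightarrow> sums_to (image_mset a (mset_set J)) s"
proof
  assume "gathers_to I a s"
  then obtain xs zs l where xs: "distinct xs" "set xs \<subseteq> I" "\<forall>i\<in>I - set xs. is_zero (a i)"
    "\<forall>z\<in>set zs. is_zero z" "length xs + length zs = l * (m - 1) + 1"
    "s = iter m \<nu> l (map a xs @ zs)"
    unfolding gathers_def by blast
  have "nonzeros (mset zs) = {#}"
    using xs(4) by (auto simp: filter_mset_eq_conv)
  moreover have "mset (map a xs) = image_mset a (mset_set (set xs))"
    using xs(1) by (simp add: mset_set_set)
  moreover have "support (set xs) a = support J a"
    using xs(2,3) assms(2,3) by auto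
  ultimately have "nonzeros (mset (map a xs @ zs)) = nonzeros (image_mset a (mset_set J))"
    using nonzeros_image_mset_set[of "set xs" a] nonzeros_image_mset_set[OF assms(1), of a] by simp
  moreover have "set (map a xs @ zs) \<subseteq> R"
    using xs(2,4) assms(4) zero_in by auto
  ultimately show "sums_to (image_mset a (mset_set J)) s"
    unfolding sums_to_def using xs(5,6) by (intro exI[of _ "map a xs @ zs"] exI[of _ l]) simp
next
  assume "sums_to (image_mset a (mset_set J)) s"
  then obtain ws l where ws: "set ws \<subseteq> R" "length ws = l * (m - 1) + 1"
    "nonzeros (mset ws) = nonzeros (image_mset a (mset_set J))" "s = iter m \<nu> l ws"
    by (auto simp: sums_to_def)
  define zs where "zs = filter is_zero ws"
  have fin: "finite (support J a)"
    using assms(1) by simp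
  then obtain xs where xs: "set xs = support J a" "distinct xs"
    using finite_distinct_list by blast
  have "mset_set (support J a) = mset xs"
    using mset_set_set[OF xs(2)] xs(1) by simp
  then have "nonzeros (mset ws) = mset (map a xs)"
    using ws(3) nonzeros_image_mset_set[OF assms(1), of a] by simp
  moreover have "mset ws = nonzeros (mset ws) + {#x \<in># mset ws. is_zero x#}"
    using multiset_partition[of "mset ws" is_zero] by (simp add: add.commute)
  ultimately have eq: "mset ws = mset (map a xs @ zs)"
    by (simp add: zs_def)
  then have "length xs + length zs = l * (m - 1) + 1"
    using mset_eq_length[OF eq] ws(2) by simp
  moreover have "s = iter m \<nu> l (map a xs @ zs)"
    unfolding ws(4) by (rule iter_permute[OF add_assoc add_comm m_ge_2 ws(2,1) eq])
  ultimately show "gathers_to I a s"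
    unfolding gathers_def using xs assms(2,3) ws(1)
    by (intro exI[of _ xs] exI[of _ zs] exI[of _ l]) (auto simp: zs_def)
qed

lemma gathers_finite_support: "gathers_to I a s \<Longrightarrow> finite (support I a)"
  unfolding gathers_def by (auto intro: finite_subset[OF _ finite_set])

lemma gathers_iff_sums_to_support:
  assumes "finite (support I a)" "a ` I \<subseteq> R"
  shows "gathers_to I a s \<longleftrightarrow> sums_to (image_mset a (mset_set (support I a))) s"
  using assms by (intro gathers_iff_sums_to) auto

lemma gathers_imp_sums_to:
  assumes "gathers_to I a s" "a ` I \<subseteq> R"
  shows "sums_to (image_mset a (mset_set (support I a))) s"
  using assms gathers_iff_sums_to_support[OF gathers_finite_support[OF assms(1)] assms(2)] by blast

lemma gathers_unique:
  assumes "gathers_to I a s" "gathers_to I a t" "a ` I \<subseteq> R"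
  shows "s = t"
  using assms by (blast intro: sums_to_unique gathers_imp_sums_to)

lemma gathers_closed:
  assumes "gathers_to I a s" "a ` I \<subseteq> R"
  shows "s \<in> R"
  using gathers_imp_sums_to[OF assms] by (rule sums_to_closed)

text \<open>Without a zero, the support is the whole index set, so that its cardinality is the number of
  summands.\<close>

lemma gathers_exists:
  assumes "finite (support I a)" "a ` I \<subseteq> R" "(\<exists>z. is_zero z) \<or> card I = l * (m - 1) + 1"
  shows "\<exists>s. gathers_to I a s"
proof -
  have "(\<exists>z. is_zero z) \<or> size (image_mset a (mset_set (support I a))) = l * (m - 1) + 1"
  proof (cases "\<exists>z. is_zero z")
    case False
    then have "support I a = I"
      by auto
    with False assms(3) show ?thesis
      by simp
  qed simp
  moreover have "set_mset (image_mset a (mset_set (support I a))) \<subseteq> R"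
    using assms(1,2) by auto
  ultimately show ?thesis
    using sums_to_exists gathers_iff_sums_to_support[OF assms(1,2)] by blast
qed

lemma gathers_zero:
  assumes "gathers_to I a s" "a ` I \<subseteq> R" "support I a = {}"
  shows "is_zero s"
  using gathers_imp_sums_to[OF assms(1,2)] by (rule sums_to_empty) (simp add: assms(3))

lemma gathers_reindex:
  assumes "bij_betw \<phi> I I'" "gathers_to I (\<lambda>i. a (\<phi> i)) s"
  shows "gathers_to I' a s"
proof -
  obtain xs zs l where xs: "distinct xs" "set xs \<subseteq> I" "\<forall>i\<in>I - set xs. is_zero (a (\<phi> i))"
    "\<forall>z\<in>set zs. is_zero z" "length xs + length zs = l * (m - 1) + 1"
    "s = iter m \<nu> l (map (\<lambda>i. a (\<phi> i)) xs @ zs)"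
    using assms(2) unfolding gathers_def by blast
  have "I' = \<phi> ` I" "inj_on \<phi> I"
    using assms(1) by (auto simp: bij_betw_def)
  with xs show ?thesis
    unfolding gathers_def
    by (intro exI[of _ "map \<phi> xs"] exI[of _ zs] exI[of _ l])
      (auto simp: distinct_map comp_def intro: inj_on_subset)
qed

lemma gathers_cong:
  assumes "gathers_to I a s" "\<And>i. i \<in> I \<Longrightarrow> a i = b i"
  shows "gathers_to I b s"
proof -
  have "map a xs = map b xs" if "set xs \<subseteq> I" for xs
    using assms(2) that by auto
  then show ?thesis
    using assms unfolding gathers_def by (metis DiffD1)
qed

lemma gathers_additive_map:
  assumes "additive_map h" "gathers_to I a s" "a ` I \<subseteq> R"
  shows "gathers_to I (\<lambda>i. h (a i)) (h s)"
proof -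
  obtain xs zs l where xs: "distinct xs" "set xs \<subseteq> I" "\<forall>i\<in>I - set xs. is_zero (a i)"
    "\<forall>z\<in>set zs. is_zero z" "length xs + length zs = l * (m - 1) + 1"
    "s = iter m \<nu> l (map a xs @ zs)"
    using assms(2) unfolding gathers_def by blast
  have "set (map a xs @ zs) \<subseteq> R"
    using xs(2,4) assms(3) zero_in by auto
  then have "h s = iter m \<nu> l (map h (map a xs @ zs))"
    unfolding xs(6) using xs(5) by (intro additive_map_iter[OF assms(1)]) auto
  with xs assms(1) show ?thesis
    unfolding gathers_def additive_map_def
    by (intro exI[of _ xs] exI[of _ "map h zs"] exI[of _ l]) (auto simp: comp_def)
qed

lemma sum_image_mset_Sigma:
  assumes "finite I" "\<And>i. i \<in> I \<Longrightarrow> finite (J i)"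
  shows "(\<Sum>i\<in>I. image_mset (c i) (mset_set (J i))) =
    image_mset (\<lambda>(i, j). c i j) (mset_set (Sigma I J))"
  using assms
proof (induction I)
  case empty
  then show ?case by simp
next
  case (insert i I)
  have "Sigma (insert i I) J = Pair i ` J i \<union> Sigma I J"
    by auto
  moreover have "mset_set (Pair i ` J i \<union> Sigma I J) = mset_set (Pair i ` J i) + mset_set (Sigma I J)"
    using insert by (intro mset_set_Union) auto
  moreover have "mset_set (Pair i ` J i) = image_mset (Pair i) (mset_set (J i))"
    by (simp add: image_mset_mset_set inj_on_def)
  ultimately show ?case
    using insert by (simp add: image_mset.compositionality comp_def)
qed

text \<open>
  Summation over pairs. Finiteness of the joint support is a genuine hypothesis: with inner sums
  that vanish by cancellation, infinitely many inner index sets could contribute nonzero terms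
  although both the outer and all inner supports are finite.
\<close>

lemma gathers_Sigma:
  assumes outer: "gathers_to I b s" "b ` I \<subseteq> R"
    and inner: "\<And>i. i \<in> I \<Longrightarrow> gathers_to (J i) (c i) (b i)"
    and cR: "\<And>i j. i \<in> I \<Longrightarrow> j \<in> J i \<Longrightarrow> c i j \<in> R"
    and fin: "finite (support (Sigma I J) (\<lambda>(i, j). c i j))"
  shows "gathers_to (Sigma I J) (\<lambda>(i, j). c i j) s"
proof -
  define P where "P = support (Sigma I J) (\<lambda>(i, j). c i j)"
  define J' where "J' = (\<lambda>i. support (J i) (c i))"
  \<comment> \<open>The outer sum runs over all indices with some nonzero inner term, also where the inner
     sum is zero.\<close>
  define I' where "I' = support I b \<union> fst ` P"
  have I': "finite I'" "I' \<subseteq> I" "support I b \<subseteq> I'"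
    using gathers_finite_support[OF outer(1)] fin by (auto simp: I'_def P_def)
  have J': "finite (J' i)" if "i \<in> I" for i
    using gathers_finite_support[OF inner[OF that]] by (simp add: J'_def)
  have "sums_to (image_mset b (mset_set I')) s"
    using gathers_iff_sums_to[OF I' outer(2)] outer(1) by simp
  moreover have "sums_to (image_mset (c i) (mset_set (J' i))) (b i)" if "i \<in> I'" for i
  proof -
    have "i \<in> I"
      using that I'(2) by blast
    with inner[of i] J'[of i] cR show ?thesis
      unfolding J'_def by (subst gathers_iff_sums_to_support[symmetric]) auto
  qed
  ultimately have "sums_to (\<Sum>i\<in>I'. image_mset (c i) (mset_set (J' i))) s"
    by (rule sums_to_subst_family[OF I'(1)])
  also have "(\<Sum>i\<in>I'. image_mset (c i) (mset_set (J' i))) =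
      image_mset (\<lambda>(i, j). c i j) (mset_set (Sigma I' J'))"
    using I' J' by (intro sum_image_mset_Sigma) auto
  finally have "sums_to (image_mset (\<lambda>(i, j). c i j) (mset_set (Sigma I' J'))) s" .
  moreover have "support (Sigma I J) (\<lambda>(i, j). c i j) \<subseteq> Sigma I' J'"
    by (force simp: I'_def P_def J'_def)
  moreover have "Sigma I' J' \<subseteq> Sigma I J" "finite (Sigma I' J')"
    using I' J' by (auto simp: J'_def)
  ultimately show ?thesis
    using cR by (subst gathers_iff_sums_to[of "Sigma I' J'"]) auto
qed

end

section \<open>The multiplication of the group ring\<close>

text \<open>The two equations for \<open>N\<close> say that \<open>N\<close>-tuples can be multiplied both in the coefficients and
  in the basis.\<close>

locale polyadic_group_ring = polyadic_coefficient_ring m n R \<nu> \<mu>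
  for m n :: nat and R :: "'r set" and \<nu> \<mu> :: "'r list \<Rightarrow> 'r" +
  fixes ng :: nat and G :: "'g set" and \<mu>G :: "'g list \<Rightarrow> 'g" and ln lg N :: nat
  assumes basis: "nary_semigroup ng G \<mu>G"
    and N_eq_ln: "N = ln * (n - 1) + 1"
    and N_eq_lg: "N = lg * (ng - 1) + 1"
    and finite_if_no_zero: "\<nexists>z. is_zero z \<Longrightarrow> finite G"
    and card_if_no_zero: "\<nexists>z. is_zero z \<Longrightarrow>
      \<forall>u\<in>G. \<exists>l. card (tuples_with_product ng G \<mu>G lg N u) = l * (m - 1) + 1"
begin

abbreviation S :: "('g \<Rightarrow> 'r) set" where
  "S \<equiv> formal_sums m n R \<nu> \<mu> G"

abbreviation product :: "('g \<Rightarrow> 'r) list \<Rightarrow> 'g \<Rightarrow> 'r" where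
  "product \<equiv> group_ring_mult m n R \<nu> \<mu> ng G \<mu>G ln lg N"

abbreviation tuples :: "nat \<Rightarrow> nat \<Rightarrow> 'g \<Rightarrow> 'g list set" where
  "tuples \<equiv> tuples_with_product ng G \<mu>G"

abbreviation term_coeff :: "nat \<Rightarrow> ('g \<Rightarrow> 'r) list \<Rightarrow> 'g list \<Rightarrow> 'r" where
  "term_coeff l rs gs \<equiv> iter n \<mu> l (map2 (\<lambda>r g. r g) rs gs)"

lemma basis_assoc: "totally_associative ng G \<mu>G" and ng_ge_2: "ng \<ge> 2"
  using basis by (auto simp: nary_semigroup_def)

text \<open>Finiteness of the support uniformly in both cases: without a zero the basis is finite.\<close>

lemma formal_sums_iff: "r \<in> S \<longleftrightarrow> r \<in> G \<rightarrow>\<^sub>E R \<and> finite (support G r)"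
proof (cases "\<exists>z. is_zero z")
  case True
  then obtain z where z: "is_zero z" ..
  then have "(\<forall>z. is_zero z \<longrightarrow> finite {g \<in> G. r g \<noteq> z}) \<longleftrightarrow> finite (support G r)"
    using zero_iff[OF z] by auto
  then show ?thesis by (simp add: formal_sums_def)
next
  case False
  then show ?thesis using finite_if_no_zero by (auto simp: formal_sums_def)
qed

lemma map2_apply_subset:
  assumes "set rs \<subseteq> S" "set gs \<subseteq> G"
  shows "set (map2 (\<lambda>r g. r g) rs gs) \<subseteq> R"
proof clarsimp
  fix r g
  assume "(r, g) \<in> set (zip rs gs)"
  then have "r \<in> S" "g \<in> G"
    using assms set_zip_leftD set_zip_rightD by fastforce+
  then show "r g \<in> R"
    by (auto simp: formal_sums_iff)
qed

lemma term_coeff_closed: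
  assumes "set rs \<subseteq> S" "set gs \<subseteq> G" "length rs = l * (n - 1) + 1" "length gs = length rs"
  shows "term_coeff l rs gs \<in> R"
  using assms map2_apply_subset by (intro iter_mult_closed) auto

text \<open>A product vanishes as soon as one factor does, so a nonzero term only involves basis
  elements in the supports of the factors.\<close>

lemma finite_support_term_coeff:
  assumes "set rs \<subseteq> S" "length rs = l * (n - 1) + 1"
  shows "finite (support {gs. length gs = length rs \<and> set gs \<subseteq> G} (term_coeff l rs))"
proof (rule finite_subset)
  define B where "B = (\<Union>r\<in>set rs. support G r)"
  show "finite {gs. set gs \<subseteq> B \<and> length gs = length rs}"
    using assms(1) by (intro finite_lists_length_eq) (auto simp: B_def formal_sums_iff)
  show "support {gs. length gs = length rs \<and> set gs \<subseteq> G} (term_coeff l rs) \<subseteq>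
      {gs. set gs \<subseteq> B \<and> length gs = length rs}"
  proof clarify
    fix gs x
    assume gs: "length gs = length rs" "set gs \<subseteq> G" "\<not> is_zero (term_coeff l rs gs)" "x \<in> set gs"
    obtain k where k: "k < length rs" "x = gs ! k"
      using gs(1,4) by (metis in_set_conv_nth)
    have "(rs ! k) x \<in> set (map2 (\<lambda>r g. r g) rs gs)"
      using k gs(1) by (force simp: set_zip)
    then have "\<not> is_zero ((rs ! k) x)"
      using iter_mult_zero map2_apply_subset assms gs by (metis length_map length_zip min.idem)
    then show "x \<in> B"
      using k gs by (auto simp: B_def)
  qed
qed

text \<open>Existence and uniqueness of the gathered value resolve the definite description in the
  product.\<close>

lemma product_gathers:
  assumes "length rs = N" "set rs \<subseteq> S" "u \<in> G"
  shows "gathers_to (tuples lg N u) (term_coeff ln rs) (product rs u)"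
proof -
  have R: "term_coeff ln rs ` tuples lg N u \<subseteq> R"
    using assms N_eq_ln by (auto simp: tuples_with_product_def intro!: term_coeff_closed)
  have "finite (support (tuples lg N u) (term_coeff ln rs))"
    using assms N_eq_ln
    by (intro finite_subset[OF _ finite_support_term_coeff[of rs ln]]) (auto simp: tuples_with_product_def)
  then have "\<exists>s. gathers_to (tuples lg N u) (term_coeff ln rs) s"
    using gathers_exists[OF _ R] card_if_no_zero assms(3) by blast
  then have "\<exists>!s. gathers_to (tuples lg N u) (term_coeff ln rs) s"
    using gathers_unique[OF _ _ R] by (intro ex_ex1I)
  then have "gathers_to (tuples lg N u) (term_coeff ln rs)
      (THE s. gathers_to (tuples lg N u) (term_coeff ln rs) s)"
    by (rule theI')
  then show ?thesis
    using assms(3) by (simp add: group_ring_mult_def)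
qed

lemma product_closed:
  assumes "length rs = N" "set rs \<subseteq> S"
  shows "product rs \<in> S"
proof -
  have R: "term_coeff ln rs ` tuples lg N u \<subseteq> R" for u
    using assms N_eq_ln by (auto simp: tuples_with_product_def intro!: term_coeff_closed)
  let ?U = "{gs. length gs = length rs \<and> set gs \<subseteq> G}"
  have "product rs \<in> G \<rightarrow>\<^sub>E R"
  proof (rule PiE_I)
    show "product rs u \<in> R" if "u \<in> G" for u
      using gathers_closed[OF product_gathers[OF assms that] R] .
  qed (simp add: group_ring_mult_def)
  moreover have "support G (product rs) \<subseteq> iter ng \<mu>G lg ` support ?U (term_coeff ln rs)"
  proof
    fix u
    assume u: "u \<in> support G (product rs)"
    then have "support (tuples lg N u) (term_coeff ln rs) \<noteq> {}"
      using gathers_zero[OF product_gathers[OF assms] R] by blast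
    then show "u \<in> iter ng \<mu>G lg ` support ?U (term_coeff ln rs)"
      using assms(1) by (auto simp: tuples_with_product_def)
  qed
  moreover have "finite (iter ng \<mu>G lg ` support ?U (term_coeff ln rs))"
    using assms N_eq_ln by (intro finite_imageI finite_support_term_coeff) simp_all
  ultimately have "product rs \<in> G \<rightarrow>\<^sub>E R" "finite (support G (product rs))"
    by (simp, elim finite_subset)
  then show ?thesis
    by (simp add: formal_sums_iff)
qed

text \<open>The inverse cuts out the \<open>N\<close> entries from position \<open>i\<close> on and puts their product in their
  place; general associativity says that the total product is unchanged.\<close>

lemma substitute_tuple_bij:
  assumes "i < N"
  shows "bij_betw (\<lambda>(gs, hs). take i gs @ hs @ drop (Suc i) gs)
    (SIGMA gs : tuples lg N u. tuples lg N (gs ! i)) (tuples (lg + lg) (2 * N - 1) u)"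
proof (rule bij_betw_byWitness[where f' = "\<lambda>ks.
    (take i ks @ iter ng \<mu>G lg (take N (drop i ks)) # drop (i + N) ks, take N (drop i ks))"])
  have absorb: "iter ng \<mu>G (lg + lg) (as @ hs @ bs) = iter ng \<mu>G lg (as @ iter ng \<mu>G lg hs # bs)"
    if "length as + length bs = N - 1" "length hs = N" "set as \<subseteq> G" "set hs \<subseteq> G" "set bs \<subseteq> G" for as hs bs
    using that N_eq_lg by (intro iter_absorb[OF basis_assoc ng_ge_2]) auto
  have sub: "set (take j gs) \<subseteq> G" "set (drop j gs) \<subseteq> G" if "set gs \<subseteq> G" for j gs
    using that set_take_subset set_drop_subset by fastforce+
  let ?D = "SIGMA gs : tuples lg N u. tuples lg N (gs ! i)"
  show "\<forall>p\<in>?D. (\<lambda>ks. (take i ks @ iter ng \<mu>G lg (take N (drop i ks)) # drop (i + N) ks,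
      take N (drop i ks))) (case p of (gs, hs) \<Rightarrow> take i gs @ hs @ drop (Suc i) gs) = p"
    using assms by (auto simp: tuples_with_product_def id_take_nth_drop[symmetric])
  show "\<forall>ks\<in>tuples (lg + lg) (2 * N - 1) u. (\<lambda>(gs, hs). take i gs @ hs @ drop (Suc i) gs)
      (take i ks @ iter ng \<mu>G lg (take N (drop i ks)) # drop (i + N) ks, take N (drop i ks)) = ks"
    using assms by (auto simp: tuples_with_product_def min_def) (metis add.commute append_take_drop_id drop_drop)
  show "(\<lambda>(gs, hs). take i gs @ hs @ drop (Suc i) gs) ` ?D \<subseteq> tuples (lg + lg) (2 * N - 1) u"
  proof clarify
    fix gs hs
    assume gs: "gs \<in> tuples lg N u" and hs: "hs \<in> tuples lg N (gs ! i)"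
    have "iter ng \<mu>G (lg + lg) (take i gs @ hs @ drop (Suc i) gs) =
        iter ng \<mu>G lg (take i gs @ gs ! i # drop (Suc i) gs)"
      using gs hs assms sub by (subst absorb) (auto simp: tuples_with_product_def)
    then show "take i gs @ hs @ drop (Suc i) gs \<in> tuples (lg + lg) (2 * N - 1) u"
      using gs hs assms sub
      by (auto simp: tuples_with_product_def id_take_nth_drop[symmetric])
  qed
  show "(\<lambda>ks. (take i ks @ iter ng \<mu>G lg (take N (drop i ks)) # drop (i + N) ks,
      take N (drop i ks))) ` tuples (lg + lg) (2 * N - 1) u \<subseteq> ?D"
  proof clarify
    fix ks
    assume ks: "ks \<in> tuples (lg + lg) (2 * N - 1) u"
    then have len: "length ks = 2 * N - 1" and G: "set ks \<subseteq> G" and u: "iter ng \<mu>G (lg + lg) ks = u"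
      by (auto simp: tuples_with_product_def)
    have split: "ks = take i ks @ take N (drop i ks) @ drop (i + N) ks"
      by (metis add.commute append_take_drop_id drop_drop)
    have "iter ng \<mu>G lg (take N (drop i ks)) \<in> G"
      using basis_assoc ng_ge_2 len sub G assms N_eq_lg
      by (intro iter_closed) (auto simp: totally_associative_def)
    moreover have "iter ng \<mu>G lg (take i ks @ iter ng \<mu>G lg (take N (drop i ks)) # drop (i + N) ks) = u"
      using u sub G len assms by (subst absorb[symmetric]) (simp_all flip: split)
    ultimately show "take i ks @ iter ng \<mu>G lg (take N (drop i ks)) # drop (i + N) ks \<in> tuples lg N u \<and>
        take N (drop i ks) \<in> tuples lg N ((take i ks @ iter ng \<mu>G lg (take N (drop i ks)) # drop (i + N) ks) ! i)"
      using len sub G assms by (auto simp: tuples_with_product_def nth_append)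
  qed
qed

text \<open>
  The gathered family and its index set are the same for all positions \<open>i\<close> of the inner product;
  as gathered values are unique, this is total associativity. The proof moves the inner sum
  out by distributivity, sums over pairs, and reindexes along the bijection.
\<close>

lemma nested_product_gathers:
  assumes "length xs = 2 * N - 1" "set xs \<subseteq> S" "i < N" "u \<in> G"
  shows "gathers_to (tuples (lg + lg) (2 * N - 1) u) (term_coeff (ln + ln) xs)
    (product (take i xs @ [product (take N (drop i xs))] @ drop (i + N) xs) u)"
proof -
  define as where "as = take i xs"
  define bs where "bs = take N (drop i xs)"
  define cs where "cs = drop (i + N) xs"
  have xs: "xs = as @ bs @ cs"
    unfolding as_def bs_def cs_def by (metis add.commute append_take_drop_id drop_drop)
  have len: "length as = i" "length bs = N" "length cs = N - 1 - i"
    using assms(1,3) by (auto simp: as_def bs_def cs_def)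
  define F where "F = product bs"
  have F: "F \<in> S"
    using product_closed[of bs] len assms(2) by (simp add: F_def xs)
  define rs where "rs = as @ F # cs"
  have rs: "length rs = N" "set rs \<subseteq> S"
    using len assms(2,3) F by (auto simp: rs_def xs)
  define \<phi> where "\<phi> = (\<lambda>(gs :: 'g list, hs :: 'g list). take i gs @ hs @ drop (Suc i) gs)"
  define I where "I = tuples lg N u"
  define J where "J = (\<lambda>gs :: 'g list. tuples lg N (gs ! i))"
  have bij: "bij_betw \<phi> (Sigma I J) (tuples (lg + lg) (2 * N - 1) u)"
    unfolding I_def J_def \<phi>_def using assms(3) by (rule substitute_tuple_bij)
  have I: "length gs = N" "set gs \<subseteq> G" if "gs \<in> I" for gs
    using that by (auto simp: I_def tuples_with_product_def)
  have J: "length hs = N" "set hs \<subseteq> G" if "hs \<in> J gs" for gs hs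
    using that by (auto simp: J_def tuples_with_product_def)
  have len2: "2 * N - 1 = (ln + ln) * (n - 1) + 1"
    using N_eq_ln by (simp add: add_mult_distrib)
  have cR: "term_coeff (ln + ln) xs ks \<in> R" if "ks \<in> tuples (lg + lg) (2 * N - 1) u" for ks
    using that assms(1,2) len2 by (intro term_coeff_closed) (auto simp: tuples_with_product_def)
  have "gathers_to (Sigma I J) (\<lambda>(gs, hs). term_coeff (ln + ln) xs (\<phi> (gs, hs))) (product rs u)"
  proof (rule gathers_Sigma)
    show "gathers_to I (term_coeff ln rs) (product rs u)"
      unfolding I_def using rs assms(4) by (rule product_gathers)
    show "term_coeff ln rs ` I \<subseteq> R"
      using rs I N_eq_ln by (auto intro!: term_coeff_closed)
    show "term_coeff (ln + ln) xs (\<phi> (gs, hs)) \<in> R" if "gs \<in> I" "hs \<in> J gs" for gs hs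
      using that bij by (intro cR) (auto simp: bij_betw_def)
    have "finite (support (tuples (lg + lg) (2 * N - 1) u) (term_coeff (ln + ln) xs))"
      using assms(1,2) len2
      by (intro finite_subset[OF _ finite_support_term_coeff[of xs "ln + ln"]])
        (auto simp: tuples_with_product_def)
    moreover have "\<phi> ` support (Sigma I J) (\<lambda>p. term_coeff (ln + ln) xs (\<phi> p)) \<subseteq>
        support (tuples (lg + lg) (2 * N - 1) u) (term_coeff (ln + ln) xs)"
      using bij by (auto simp: bij_betw_def)
    moreover have "inj_on \<phi> (support (Sigma I J) (\<lambda>p. term_coeff (ln + ln) xs (\<phi> p)))"
      using bij by (auto simp: bij_betw_def intro: inj_on_subset)
    ultimately show "finite (support (Sigma I J) (\<lambda>(gs, hs). term_coeff (ln + ln) xs (\<phi> (gs, hs))))"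
      using inj_on_finite by (simp add: case_prod_beta) blast
    show "gathers_to (J gs) (\<lambda>hs. term_coeff (ln + ln) xs (\<phi> (gs, hs))) (term_coeff ln rs gs)"
      if "gs \<in> I" for gs
    proof -
      let ?base = "map2 (\<lambda>r g. r g) rs gs"
      define h where "h = (\<lambda>x. iter n \<mu> ln (?base[i := x]))"
      have gi: "gs ! i \<in> G"
        using I[OF that] assms(3) nth_mem by blast
      define us where "us = map2 (\<lambda>r g. r g) as (take i gs)"
      define vs where "vs = map2 (\<lambda>r g. r g) cs (drop (Suc i) gs)"
      have "gs = take i gs @ gs ! i # drop (Suc i) gs"
        using I[OF that] assms(3) by (simp add: id_take_nth_drop)
      then have "?base = map2 (\<lambda>r g. r g) rs (take i gs @ gs ! i # drop (Suc i) gs)"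
        by simp
      also have "\<dots> = us @ F (gs ! i) # vs"
        using len I[OF that] assms(3) by (simp add: rs_def us_def vs_def)
      finally have base: "?base = us @ F (gs ! i) # vs" .
      have lenus: "length us = i" "length vs = N - 1 - i"
        using len I[OF that] assms(3) by (simp_all add: us_def vs_def)
      have R: "set us \<subseteq> R" "set vs \<subseteq> R"
        using map2_apply_subset[OF rs(2) I(2)[OF that]] unfolding base by auto
      have h_eq: "h x = iter n \<mu> ln (us @ x # vs)" for x
        using lenus by (simp add: h_def base list_update_append)
      have "additive_map h"
        unfolding h_def using rs I[OF that] map2_apply_subset N_eq_ln assms(3)
        by (intro iter_mult_additive) auto
      moreover have "gathers_to (J gs) (term_coeff ln bs) (F (gs ! i))"
        unfolding J_def F_def using len assms(2) gi by (intro product_gathers) (auto simp: xs)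
      moreover have "term_coeff ln bs ` J gs \<subseteq> R"
      proof (rule image_subsetI)
        show "term_coeff ln bs hs \<in> R" if "hs \<in> J gs" for hs
          using len(2) assms(2) J[OF that] N_eq_ln by (intro term_coeff_closed) (simp_all add: xs)
      qed
      ultimately have "gathers_to (J gs) (\<lambda>hs. h (term_coeff ln bs hs)) (h (F (gs ! i)))"
        by (rule gathers_additive_map)
      moreover have "h (F (gs ! i)) = term_coeff ln rs gs"
        by (simp add: h_eq base)
      moreover have "h (term_coeff ln bs hs) = term_coeff (ln + ln) xs (\<phi> (gs, hs))" if "hs \<in> J gs" for hs
      proof -
        have "h (term_coeff ln bs hs) = iter n \<mu> (ln + ln) (us @ map2 (\<lambda>r g. r g) bs hs @ vs)"
          unfolding h_eq using lenus len J[OF that] R N_eq_ln assms(2,3) map2_apply_subset[of bs hs]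
          by (intro iter_absorb[OF mult_assoc n_ge_2, symmetric]) (auto simp: xs)
        also have "us @ map2 (\<lambda>r g. r g) bs hs @ vs = map2 (\<lambda>r g. r g) xs (\<phi> (gs, hs))"
          using len J[OF that] I[OF \<open>gs \<in> I\<close>] assms(3) by (simp add: xs \<phi>_def us_def vs_def)
        finally show ?thesis .
      qed
      ultimately show ?thesis
        by (metis (no_types, lifting) gathers_cong)
    qed
  qed
  then have "gathers_to (tuples (lg + lg) (2 * N - 1) u) (term_coeff (ln + ln) xs) (product rs u)"
    by (intro gathers_reindex[OF bij]) (simp add: case_prod_unfold)
  then show ?thesis
    by (simp add: rs_def F_def as_def bs_def cs_def)
qed

lemma product_totally_associative: "totally_associative N S product"
  unfolding totally_associative_def nary_op_def
proof (intro conjI allI impI)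
  show "product rs \<in> S" if "length rs = N \<and> set rs \<subseteq> S" for rs
    using that by (intro product_closed) auto
next
  fix xs i j
  assume xs: "length xs = 2 * N - 1 \<and> set xs \<subseteq> S" and i: "i < N" and j: "j < N"
  let ?P = "\<lambda>i. product (take i xs @ [product (take N (drop i xs))] @ drop (i + N) xs)"
  have "?P i u = ?P j u" if "u \<in> G" for u
  proof (rule gathers_unique)
    have "2 * N - 1 = (ln + ln) * (n - 1) + 1"
      using N_eq_ln by (simp add: add_mult_distrib)
    then show "term_coeff (ln + ln) xs ` tuples (lg + lg) (2 * N - 1) u \<subseteq> R"
      using xs by (auto intro!: term_coeff_closed simp: tuples_with_product_def)
  qed (use xs i j that in \<open>auto intro!: nested_product_gathers[simplified]\<close>)
  moreover have "?P i u = ?P j u" if "u \<notin> G" for u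
    using that by (simp add: group_ring_mult_def)
  ultimately show "?P i = ?P j" by blast
qed

end

theorem theorem5p3:
  fixes R :: "'r set" and \<nu> \<mu> :: "'r list \<Rightarrow> 'r"
    and G :: "'g set" and \<mu>G :: "'g list \<Rightarrow> 'g"
    and mr nr ng ln lg N :: nat
  assumes "polyadic_ring mr nr R \<nu> \<mu>"
    and "nary_group ng G \<mu>G"
    and "ln \<ge> 1" and "lg \<ge> 1" and "ln > 1 \<or> lg > 1"
    and "N = ln * (nr - 1) + 1" and "N = lg * (ng - 1) + 1"
    and "N > nr \<or> N > ng"
    and "(\<nexists>z. polyadic_zero mr nr R \<nu> \<mu> z) \<Longrightarrow> finite G"
    and "(\<nexists>z. polyadic_zero mr nr R \<nu> \<mu> z) \<Longrightarrow>
           \<forall>u\<in>G. \<exists>l. card (tuples_with_product ng G \<mu>G lg N u) = l * (mr - 1) + 1"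
  shows "totally_associative N (formal_sums mr nr R \<nu> \<mu> G)
           (group_ring_mult mr nr R \<nu> \<mu> ng G \<mu>G ln lg N)"
proof -
  interpret polyadic_coefficient_ring mr nr R \<nu> \<mu>
    using assms(1) by unfold_locales
  interpret polyadic_group_ring mr nr R \<nu> \<mu> ng G \<mu>G ln lg N
    using assms by unfold_locales (auto simp: nary_group_def)
  show ?thesis by (rule product_totally_associative)
qed

end
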